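(* Let $\{i,j\}=\{1,2\}$. A Noetherian bilocale $(L,L_1,L_2)$ is $(i,j)$-Baire if and only if its ideal bilocale $(\mathfrak J L,(\mathfrak J L)_1,(\mathfrak J L)_2)$ is $(i,j)$-Baire.
   Context: A locale is a complete lattice $L$ with $a\wedge\bigvee B=\bigvee\{a\wedge b:b\in B\}$ for all $a\in L$, $B\subseteq L$; $\to$ is its Heyting operation. A subframe of $L$ is a subset closed under all joins and finite meets. A bilocale is a triple $(L,L_1,L_2)$ with $L_1,L_2$ subframes of a locale $L$ such that $a=\bigvee\{a_1\wedge a_2:a_1\in L_1,a_2\in L_2,a_1\wedge a_2\le a\}$ for all $a\in L$. It is Noetherian if every element $x\in L$ is compact, i.e. $x\le\bigvee A$ with $A\subseteq L$ implies $x\le\bigvee F$ for some finite $F\subseteq A$. The ideal bilocale of $(L,L_1,L_2)$ is $(\mathfrak J L,(\mathfrak J L)_1,(\mathfrak J L)_2)$, where $\mathfrak J L$ is the locale of all ideals of $L$ ordered by inclusion and $(\mathfrak J L)_k$ ($k=1,2$) is the subframe of $\mathfrak J L$ consisting of all ideals $J\subseteq L$ generated (as ideals) by $J\cap L_k$. A sublocale of $L$ is a subset $S$ closed under all meets with $x\to s\in S$ for all $x\in L$, $s\in S$. For $a\in L$, $\mathfrak o(a)=\{a\to x:x\in L\}$ is an open sublocale and $\mathfrak c(a)=\{x\in L:a\le x\}$ a closed sublocale. A sublocale is $j$-open if it equals $\mathfrak o(a)$ for some $a\in L_j$; $S$ is $i$-dense if $\bigcap\{\mathfrak c(a):a\in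 L_i,\ S\subseteq\mathfrak c(a)\}=L$. A bilocale is $(i,j)$-Baire if the intersection of any countably many $i$-dense $j$-open sublocales is $i$-dense. *)

theory Defs
  imports Main "HOL-Library.Countable_Set"
begin

text \<open>A locale \<open>L\<close> is a type \<open>'a\<close> of class \<open>frame\<close>; the set \<open>L\<close> itself is \<^term>\<open>UNIV :: 'a set\<close>.
  The library's class \<open>complete_distrib_lattice\<close> is too strong, since it demands complete
  distributivity.\<close>

class frame = complete_lattice +
  assumes inf_Sup_distrib: "inf a (Sup B) = Sup {inf a b | b. b \<in> B}"

definition heyting_imp :: "'a::frame \<Rightarrow> 'a \<Rightarrow> 'a"
  where "heyting_imp a b = Sup {x. inf x a \<le> b}"

lemma le_heyting_imp_iff: "x \<le> heyting_imp a b \<longleftrightarrow> inf x a \<le> b" for a b :: "'a::frame"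
proof
  have "inf a (heyting_imp a b) \<le> b"
    unfolding heyting_imp_def inf_Sup_distrib
    by (rule Sup_least) (auto simp: inf_commute)
  moreover assume "x \<le> heyting_imp a b"
  ultimately show "inf x a \<le> b"
    by (metis inf.absorb_iff2 inf.coboundedI1 inf.commute inf.left_commute order_trans)
next
  assume "inf x a \<le> b"
  then show "x \<le> heyting_imp a b"
    unfolding heyting_imp_def by (auto intro: Sup_upper)
qed

definition subframe :: "'a::frame set \<Rightarrow> bool"
  where "subframe S \<longleftrightarrow>
    (\<forall>A\<subseteq>S. Sup A \<in> S) \<and> (\<forall>F\<subseteq>S. finite F \<longrightarrow> Inf F \<in> S)"

lemma subframe_Sup: "\<lbrakk>subframe S; A \<subseteq> S\<rbrakk> \<Longrightarrow> Sup A \<in> S"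
  by (simp add: subframe_def)

lemma subframe_Inf: "\<lbrakk>subframe S; F \<subseteq> S; finite F\<rbrakk> \<Longrightarrow> Inf F \<in> S"
  by (simp add: subframe_def)

definition bilocale :: "'a::frame set \<Rightarrow> 'a set \<Rightarrow> bool"
  where "bilocale L1 L2 \<longleftrightarrow> subframe L1 \<and> subframe L2 \<and>
    (\<forall>a. a = Sup {inf a1 a2 | a1 a2. a1 \<in> L1 \<and> a2 \<in> L2 \<and> inf a1 a2 \<le> a})"

definition compact_element :: "'a::frame \<Rightarrow> bool"
  where "compact_element x \<longleftrightarrow>
    (\<forall>A. x \<le> Sup A \<longrightarrow> (\<exists>F. finite F \<and> F \<subseteq> A \<and> x \<le> Sup F))"

definition noetherian_bilocale :: "'a::frame set \<Rightarrow> 'a set \<Rightarrow> bool"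
  where "noetherian_bilocale L1 L2 \<longleftrightarrow>
    bilocale L1 L2 \<and> (\<forall>x::'a. compact_element x)"

definition is_sublocale :: "'a::frame set \<Rightarrow> bool"
  where "is_sublocale S \<longleftrightarrow>
    (\<forall>A\<subseteq>S. Inf A \<in> S) \<and> (\<forall>x. \<forall>s\<in>S. heyting_imp x s \<in> S)"

definition open_sublocale :: "'a::frame \<Rightarrow> 'a set"
  where "open_sublocale a = {heyting_imp a x | x. True}"

definition closed_sublocale :: "'a::frame \<Rightarrow> 'a set"
  where "closed_sublocale a = {x. a \<le> x}"

lemma is_sublocale_open: "is_sublocale (open_sublocale a)" for a :: "'a::frame"
  unfolding is_sublocale_def
proof (intro conjI allI impI ballI)
  fix A assume A: "A \<subseteq> open_sublocale a"
  have "heyting_imp a (Inf A) \<le> s" if s: "s \<in> A" for s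
  proof -
    obtain x where x: "s = heyting_imp a x"
      using A s unfolding open_sublocale_def by blast
    have "inf (heyting_imp a (Inf A)) a \<le> s"
      using s le_heyting_imp_iff order_refl by (meson Inf_lower order_trans)
    then have "inf (inf (heyting_imp a (Inf A)) a) a \<le> x"
      by (simp only: x le_heyting_imp_iff)
    then show ?thesis by (simp add: x le_heyting_imp_iff inf_assoc)
  qed
  then have "heyting_imp a (Inf A) \<le> Inf A" by (rule Inf_greatest)
  moreover have "Inf A \<le> heyting_imp a (Inf A)" by (simp add: le_heyting_imp_iff)
  ultimately have "Inf A = heyting_imp a (Inf A)" by (rule order.antisym[rotated])
  then show "Inf A \<in> open_sublocale a" unfolding open_sublocale_def by blast
next
  fix x s assume "s \<in> open_sublocale a"
  then obtain y where y: "s = heyting_imp a y" by (auto simp: open_sublocale_def)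
  have "z \<le> heyting_imp x s \<longleftrightarrow> z \<le> heyting_imp a (heyting_imp x y)" for z
    by (simp add: y le_heyting_imp_iff ac_simps)
  then have "heyting_imp x s = heyting_imp a (heyting_imp x y)"
    by (meson order.antisym order_refl)
  then show "heyting_imp x s \<in> open_sublocale a" unfolding open_sublocale_def by blast
qed

text \<open>In the next two definitions \<open>P\<close> is the part \<open>L\<^sub>k\<close> of the bilocale, so that they describe
  \<open>k\<close>-open and \<open>k\<close>-dense sublocales.\<close>

definition part_open :: "'a::frame set \<Rightarrow> 'a set \<Rightarrow> bool"
  where "part_open P S \<longleftrightarrow> is_sublocale S \<and> (\<exists>a\<in>P. S = open_sublocale a)"

definition part_dense :: "'a::frame set \<Rightarrow> 'a set \<Rightarrow> bool"
  where "part_dense P S \<longleftrightarrow>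
    \<Inter> {closed_sublocale a | a. a \<in> P \<and> S \<subseteq> closed_sublocale a} = UNIV"

text \<open>Only the indices 1 and 2 are meaningful.\<close>

definition part :: "'a set \<Rightarrow> 'a set \<Rightarrow> nat \<Rightarrow> 'a set"
  where "part L1 L2 k = (if k = 1 then L1 else L2)"

text \<open>The meet of sublocales is their intersection as sets. A countable family may be empty, finite
  or infinite; the empty intersection is the whole locale.\<close>

definition baire :: "nat \<Rightarrow> nat \<Rightarrow> 'a::frame set \<Rightarrow> 'a set \<Rightarrow> bool"
  where "baire i j L1 L2 \<longleftrightarrow>
    (\<forall>\<S>. countable \<S> \<and>
         (\<forall>S\<in>\<S>. part_dense (part L1 L2 i) S \<and> part_open (part L1 L2 j) S)
       \<longrightarrow> part_dense (part L1 L2 i) (\<Inter>\<S>))"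

definition is_ideal :: "'a::frame set \<Rightarrow> bool"
  where "is_ideal J \<longleftrightarrow> J \<noteq> {} \<and> (\<forall>x\<in>J. \<forall>y. y \<le> x \<longrightarrow> y \<in> J) \<and>
    (\<forall>x\<in>J. \<forall>y\<in>J. sup x y \<in> J)"

typedef (overloaded) 'a ideal = "{J :: 'a::frame set. is_ideal J}"
  morphisms ideal_set Abs_ideal
  by (rule exI[of _ UNIV]) (simp add: is_ideal_def)

setup_lifting type_definition_ideal

lemma bot_in_ideal: "is_ideal J \<Longrightarrow> bot \<in> J"
  unfolding is_ideal_def by (metis bot_least ex_in_conv)

lemma is_ideal_Inter:
  assumes "\<And>J. J \<in> \<J> \<Longrightarrow> is_ideal J" shows "is_ideal (\<Inter>\<J>)"
proof -
  have "bot \<in> \<Inter>\<J>" using assms bot_in_ideal by auto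
  then show ?thesis using assms unfolding is_ideal_def by blast
qed

instantiation ideal :: (frame) complete_lattice
begin

lift_definition less_eq_ideal :: "'a ideal \<Rightarrow> 'a ideal \<Rightarrow> bool" is "(\<subseteq>)" .

lift_definition less_ideal :: "'a ideal \<Rightarrow> 'a ideal \<Rightarrow> bool" is "(\<subset>)" .

lift_definition Inf_ideal :: "'a ideal set \<Rightarrow> 'a ideal" is "\<lambda>\<J>. \<Inter>\<J>"
  by (rule is_ideal_Inter) auto

lift_definition inf_ideal :: "'a ideal \<Rightarrow> 'a ideal \<Rightarrow> 'a ideal" is "(\<inter>)"
  using is_ideal_Inter[of "{_, _}"] by auto

lift_definition top_ideal :: "'a ideal" is UNIV
  by (simp add: is_ideal_def)

lift_definition bot_ideal :: "'a ideal" is "{bot}"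
  by (auto simp: is_ideal_def bot_unique)

definition Sup_ideal :: "'a ideal set \<Rightarrow> 'a ideal"
  where "Sup_ideal \<J> = Inf {K. \<forall>J\<in>\<J>. J \<le> K}"

definition sup_ideal :: "'a ideal \<Rightarrow> 'a ideal \<Rightarrow> 'a ideal"
  where "sup_ideal J K = Inf {M. J \<le> M \<and> K \<le> M}"

instance
proof
  have Inf_lower: "Inf \<J> \<le> J" if "J \<in> \<J>" for J :: "'a ideal" and \<J>
    using that by transfer blast
  have Inf_greatest: "K \<le> Inf \<J>" if "\<And>J. J \<in> \<J> \<Longrightarrow> K \<le> J" for K :: "'a ideal" and \<J>
    using that by transfer blast
  fix I J K :: "'a ideal" and \<J> :: "'a ideal set"
  show "(I < J) = (I \<le> J \<and> \<not> J \<le> I)" by transfer blast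
  show "I \<le> I" by transfer blast
  show "I \<le> K" if "I \<le> J" "J \<le> K" using that by transfer blast
  show "I = J" if "I \<le> J" "J \<le> I" using that by transfer blast
  show "inf I J \<le> I" "inf I J \<le> J" by (transfer, blast)+
  show "I \<le> inf J K" if "I \<le> J" "I \<le> K" using that by transfer blast
  show "I \<le> sup I J" "J \<le> sup I J"
    unfolding sup_ideal_def by (auto intro: Inf_greatest)
  show "sup J K \<le> I" if "J \<le> I" "K \<le> I"
    unfolding sup_ideal_def using that by (auto intro: Inf_lower)
  show "Inf \<J> \<le> I" if "I \<in> \<J>" using that by (rule Inf_lower)
  show "I \<le> Inf \<J>" if "\<And>J. J \<in> \<J> \<Longrightarrow> I \<le> J" using that by (rule Inf_greatest)
  show "I \<le> Sup \<J>" if "I \<in> \<J>"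
    unfolding Sup_ideal_def using that by (auto intro: Inf_greatest)
  show "Sup \<J> \<le> I" if "\<And>J. J \<in> \<J> \<Longrightarrow> J \<le> I"
    unfolding Sup_ideal_def using that by (auto intro: Inf_lower)
  show "Inf {} = (top :: 'a ideal)" by transfer simp
  have "bot \<le> I" for I :: "'a ideal" by transfer (simp add: bot_in_ideal)
  then have "(bot :: 'a ideal) \<le> Sup {}"
    unfolding Sup_ideal_def by (intro Inf_greatest)
  moreover have "Sup {} \<le> (bot :: 'a ideal)"
    unfolding Sup_ideal_def by (intro Inf_lower) simp
  ultimately show "Sup {} = (bot :: 'a ideal)"
    by (simp add: less_eq_ideal.rep_eq flip: ideal_set_inject)
qed

end

lemma is_ideal_ideal_set: "is_ideal (ideal_set J)"
  using ideal_set by blast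

lemma ideal_down: "\<lbrakk>x \<in> ideal_set J; y \<le> x\<rbrakk> \<Longrightarrow> y \<in> ideal_set J"
  using is_ideal_ideal_set[of J] unfolding is_ideal_def by blast

lemma ideal_sup: "\<lbrakk>x \<in> ideal_set J; y \<in> ideal_set J\<rbrakk> \<Longrightarrow> sup x y \<in> ideal_set J"
  using is_ideal_ideal_set[of J] unfolding is_ideal_def by blast

lemma ideal_bot: "bot \<in> ideal_set J"
  by (rule bot_in_ideal[OF is_ideal_ideal_set])

lemma inf_sup_frame: "inf a (sup b c) = sup (inf a b) (inf a c)" for a b c :: "'a::frame"
proof -
  have "{inf a x | x. x \<in> {b, c}} = {inf a b, inf a c}" by auto
  then show ?thesis using inf_Sup_distrib[of a "{b, c}"] by simp
qed

instance ideal :: (frame) frame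
proof
  fix J :: "'a ideal" and \<K> :: "'a ideal set"
  let ?M = "Sup {inf J K | K. K \<in> \<K>}"
  define R where "R = Abs_ideal {x. \<forall>y\<in>ideal_set J. inf y x \<in> ideal_set ?M}"
  have "is_ideal {x. \<forall>y\<in>ideal_set J. inf y x \<in> ideal_set ?M}"
    unfolding is_ideal_def
  proof (intro conjI ballI allI impI)
    show "{x. \<forall>y\<in>ideal_set J. inf y x \<in> ideal_set ?M} \<noteq> {}"
      using ideal_bot[of ?M] by (auto intro!: exI[of _ bot])
  next
    fix x y z
    assume "x \<in> {x. \<forall>y\<in>ideal_set J. inf y x \<in> ideal_set ?M}" "y \<le> x"
    then show "y \<in> {x. \<forall>y\<in>ideal_set J. inf y x \<in> ideal_set ?M}"
      using ideal_down[OF _ inf_mono[OF order_refl]] by blast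
  qed (simp add: inf_sup_frame ideal_sup)
  then have R: "ideal_set R = {x. \<forall>y\<in>ideal_set J. inf y x \<in> ideal_set ?M}"
    unfolding R_def by (simp add: Abs_ideal_inverse)
  have "K \<le> R" if "K \<in> \<K>" for K
    unfolding less_eq_ideal.rep_eq
  proof
    fix x assume x: "x \<in> ideal_set K"
    have "inf J K \<le> ?M" using that by (auto intro: Sup_upper)
    then have *: "ideal_set J \<inter> ideal_set K \<subseteq> ideal_set ?M"
      unfolding less_eq_ideal.rep_eq inf_ideal.rep_eq .
    have "inf y x \<in> ideal_set ?M" if "y \<in> ideal_set J" for y
      using * x that ideal_down[of x K "inf y x"] ideal_down[of y J "inf y x"] by auto
    then show "x \<in> ideal_set R" by (simp add: R)
  qed
  then have "Sup \<K> \<le> R" by (rule Sup_least)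
  then have le: "ideal_set (Sup \<K>) \<subseteq> ideal_set R" unfolding less_eq_ideal.rep_eq .
  have "inf J (Sup \<K>) \<le> ?M"
    unfolding less_eq_ideal.rep_eq inf_ideal.rep_eq
  proof
    fix x assume "x \<in> ideal_set J \<inter> ideal_set (Sup \<K>)"
    then have "inf x x \<in> ideal_set ?M" using le unfolding R by blast
    then show "x \<in> ideal_set ?M" by simp
  qed
  moreover have "?M \<le> inf J (Sup \<K>)"
    by (rule Sup_least) (auto intro: le_infI2 Sup_upper)
  ultimately show "inf J (Sup \<K>) = ?M" by (rule order.antisym)
qed

definition ideal_generated :: "'a::frame set \<Rightarrow> 'a ideal"
  where "ideal_generated A = Inf {K. A \<subseteq> ideal_set K}"

definition ideal_part :: "'a::frame set \<Rightarrow> 'a ideal set"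
  where "ideal_part P = {J. J = ideal_generated (ideal_set J \<inter> P)}"

lemma ideal_generated_iff:
  assumes "D \<noteq> {}" "\<And>x y. \<lbrakk>x \<in> D; y \<in> D\<rbrakk> \<Longrightarrow> sup x y \<in> D"
  shows "x \<in> ideal_set (ideal_generated D) \<longleftrightarrow> (\<exists>d\<in>D. x \<le> d)"
proof
  let ?E = "{x. \<exists>d\<in>D. x \<le> d}"
  have "sup x y \<in> ?E" if xy: "x \<in> ?E" "y \<in> ?E" for x y
  proof -
    obtain d e where "d \<in> D" "x \<le> d" "e \<in> D" "y \<le> e" using xy by blast
    then show ?thesis using assms(2) sup_mono by blast
  qed
  moreover have "?E \<noteq> {}" using assms(1) by auto
  ultimately have "is_ideal ?E"
    unfolding is_ideal_def using order_trans by blast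
  then have E: "ideal_set (Abs_ideal ?E) = ?E" by (simp add: Abs_ideal_inverse)
  then have "ideal_generated D \<le> Abs_ideal ?E"
    unfolding ideal_generated_def by (intro Inf_lower) auto
  then show "\<exists>d\<in>D. x \<le> d" if "x \<in> ideal_set (ideal_generated D)"
    using that E unfolding less_eq_ideal.rep_eq by blast
next
  show "x \<in> ideal_set (ideal_generated D)" if "\<exists>d\<in>D. x \<le> d"
  proof -
    from that obtain d where d: "d \<in> D" "x \<le> d" by blast
    have "d \<in> ideal_set (ideal_generated D)"
      using d(1) unfolding ideal_generated_def Inf_ideal.rep_eq by blast
    then show ?thesis using d(2) by (rule ideal_down)
  qed
qed

lemma ideal_part_iff:
  assumes "subframe P"
  shows "J \<in> ideal_part P \<longleftrightarrow> (\<forall>x\<in>ideal_set J. \<exists>p\<in>ideal_set J \<inter> P. x \<le> p)"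
proof -
  have bot: "bot \<in> P" using subframe_Sup[OF assms, of "{}"] by simp
  have sup: "sup x y \<in> P" if "x \<in> P" "y \<in> P" for x y
    using subframe_Sup[OF assms, of "{x, y}"] that by simp
  have gen: "x \<in> ideal_set (ideal_generated (ideal_set J \<inter> P)) \<longleftrightarrow>
      (\<exists>p\<in>ideal_set J \<inter> P. x \<le> p)" for x
  proof (rule ideal_generated_iff)
    show "ideal_set J \<inter> P \<noteq> {}" using bot ideal_bot[of J] by blast
  qed (simp add: sup ideal_sup)
  have down: "x \<in> ideal_set J" if "\<exists>p\<in>ideal_set J \<inter> P. x \<le> p" for x
    using that ideal_down[of _ J x] by blast
  let ?G = "ideal_generated (ideal_set J \<inter> P)"
  have "J \<in> ideal_part P \<longleftrightarrow> ideal_set J = ideal_set ?G"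
    unfolding ideal_part_def mem_Collect_eq ideal_set_inject ..
  also have "\<dots> \<longleftrightarrow> ideal_set J \<subseteq> ideal_set ?G"
  proof -
    have "ideal_set ?G \<subseteq> ideal_set J"
    proof
      fix x assume "x \<in> ideal_set ?G"
      then show "x \<in> ideal_set J" unfolding gen by (rule down)
    qed
    then show ?thesis by (simp only: set_eq_subset simp_thms)
  qed
  also have "\<dots> \<longleftrightarrow> (\<forall>x\<in>ideal_set J. \<exists>p\<in>ideal_set J \<inter> P. x \<le> p)"
    unfolding subset_eq gen ..
  finally show ?thesis .
qed

lemma subframe_ideal_part:
  assumes P: "subframe P" shows "subframe (ideal_part P)"
  unfolding subframe_def
proof (intro conjI allI impI)
  fix \<J> assume sub: "\<J> \<subseteq> ideal_part P"
  let ?G = "ideal_generated (ideal_set (Sup \<J>) \<inter> P)"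
  have "J \<le> ?G" if "J \<in> \<J>" for J
  proof -
    have "ideal_set J \<subseteq> ideal_set (Sup \<J>)"
      using Sup_upper[OF that] unfolding less_eq_ideal.rep_eq .
    then have "ideal_generated (ideal_set J \<inter> P) \<le> ?G"
      unfolding ideal_generated_def by (intro Inf_superset_mono) auto
    then show ?thesis using sub that unfolding ideal_part_def by auto
  qed
  then have "Sup \<J> \<le> ?G" by (rule Sup_least)
  moreover have "?G \<le> Sup \<J>"
    unfolding ideal_generated_def by (rule Inf_lower) auto
  ultimately show "Sup \<J> \<in> ideal_part P"
    unfolding ideal_part_def by (auto intro: order.antisym)
next
  fix \<J> assume sub: "\<J> \<subseteq> ideal_part P" and fin: "finite \<J>"
  show "Inf \<J> \<in> ideal_part P"
    unfolding ideal_part_iff[OF P]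
  proof
    fix x assume x: "x \<in> ideal_set (Inf \<J>)"
    have "\<exists>p. p \<in> ideal_set J \<inter> P \<and> x \<le> p" if "J \<in> \<J>" for J
      using sub that x ideal_part_iff[OF P, of J] unfolding Inf_ideal.rep_eq by blast
    then obtain p where p: "\<And>J. J \<in> \<J> \<Longrightarrow> p J \<in> ideal_set J \<inter> P \<and> x \<le> p J" by metis
    have "Inf (p ` \<J>) \<in> P"
    proof -
      have "p ` \<J> \<subseteq> P" "finite (p ` \<J>)" using p fin by auto
      then show ?thesis by (rule subframe_Inf[OF P])
    qed
    moreover have "Inf (p ` \<J>) \<in> ideal_set (Inf \<J>)"
      unfolding Inf_ideal.rep_eq
    proof (rule INT_I)
      fix J assume J: "J \<in> \<J>"
      have "Inf (p ` \<J>) \<le> p J" using J by (rule INF_lower)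
      moreover have "p J \<in> ideal_set J" using p J by blast
      ultimately show "Inf (p ` \<J>) \<in> ideal_set J" by (rule ideal_down[rotated])
    qed
    moreover have "x \<le> Inf (p ` \<J>)" using p by (auto intro: INF_greatest)
    ultimately show "\<exists>p\<in>ideal_set (Inf \<J>) \<inter> P. x \<le> p" by blast
  qed
qed

text \<open>For arbitrary bilocales the two parts need not generate the locale of all ideals; compactness
  of the elements is needed.\<close>

lemma bilocale_ideal:
  fixes L1 L2 :: "'a::frame set"
  assumes "noetherian_bilocale L1 L2"
  shows "bilocale (ideal_part L1) (ideal_part L2)"
proof -
  have L: "subframe L1" "subframe L2"
    and gen: "\<And>a. a = Sup {inf a1 a2 | a1 a2. a1 \<in> L1 \<and> a2 \<in> L2 \<and> inf a1 a2 \<le> a}"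
    and cpt: "\<And>x::'a. compact_element x"
    using assms unfolding noetherian_bilocale_def bilocale_def by blast+
  define pr where "pr a = Abs_ideal {..a}" for a :: 'a
  have pr: "ideal_set (pr a) = {..a}" for a
    unfolding pr_def by (rule Abs_ideal_inverse) (auto simp: is_ideal_def intro: order_trans)
  have pr_part: "pr a \<in> ideal_part P" if "a \<in> P" "subframe P" for a P
    unfolding ideal_part_iff[OF that(2)] pr using that by auto
  have "J = Sup {inf J1 J2 | J1 J2. J1 \<in> ideal_part L1 \<and> J2 \<in> ideal_part L2 \<and> inf J1 J2 \<le> J}"
    (is "J = Sup ?S") for J
  proof (rule order.antisym)
    show "J \<le> Sup ?S"
    proof (subst less_eq_ideal.rep_eq, rule subsetI)
      fix x assume x: "x \<in> ideal_set J"
      let ?A = "{inf a1 a2 | a1 a2. a1 \<in> L1 \<and> a2 \<in> L2 \<and> inf a1 a2 \<le> x}"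
      have "x \<le> Sup ?A" using gen[of x] by (rule eq_refl)
      then obtain F where F: "finite F" "F \<subseteq> ?A" "x \<le> Sup F"
        using cpt[of x] unfolding compact_element_def by blast
      have "y \<in> ideal_set (Sup ?S)" if y: "y \<in> ?A" for y
      proof -
        obtain a1 a2 where a: "y = inf a1 a2" "a1 \<in> L1" "a2 \<in> L2" "inf a1 a2 \<le> x"
          using y by blast
        have "inf (pr a1) (pr a2) \<le> J"
          unfolding less_eq_ideal.rep_eq inf_ideal.rep_eq pr
        proof
          fix z assume "z \<in> {..a1} \<inter> {..a2}"
          then have "z \<le> x" using a(4) by (auto intro: order_trans[of z "inf a1 a2"])
          with x show "z \<in> ideal_set J" by (rule ideal_down)
        qed
        then have "inf (pr a1) (pr a2) \<in> ?S" using a pr_part L by blast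
        then have "inf (pr a1) (pr a2) \<le> Sup ?S" by (rule Sup_upper)
        then have "ideal_set (inf (pr a1) (pr a2)) \<subseteq> ideal_set (Sup ?S)"
          by (subst (asm) less_eq_ideal.rep_eq)
        then show ?thesis
          unfolding inf_ideal.rep_eq pr a(1) by auto
      qed
      then have "F \<subseteq> ideal_set (Sup ?S)" using F(2) by blast
      with F(1) have "Sup F \<in> ideal_set (Sup ?S)"
        by (induction F) (simp_all only: Sup_empty Sup_insert ideal_bot insert_subset ideal_sup)
      then show "x \<in> ideal_set (Sup ?S)" using F(3) by (rule ideal_down)
    qed
  qed (rule Sup_least, blast)
  then show ?thesis
    unfolding bilocale_def using L subframe_ideal_part by blast
qed

end

theory Submission
  imports Defs
begin

text \<open>If every element of \<open>L\<close> is compact, an ideal contains its own join, so every ideal is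
  principal and \<open>a \<mapsto> {..a}\<close> is an order isomorphism from \<open>L\<close> onto \<open>\<JJ> L\<close>. It carries \<open>L\<^sub>k\<close> onto
  \<open>(\<JJ> L)\<^sub>k\<close>, and the Baire property is invariant under order isomorphisms.\<close>

lemma part_open_iff: "part_open P S \<longleftrightarrow> (\<exists>a\<in>P. S = open_sublocale a)"
  unfolding part_open_def using is_sublocale_open by blast

text \<open>An intersection is the whole locale iff each of its members is, and
  \<open>closed_sublocale a\<close> is the whole locale iff \<open>a\<close> lies below everything.
  Phrasing this by the order alone lets it transfer along order isomorphisms.\<close>

lemma part_dense_iff: "part_dense P S \<longleftrightarrow> (\<forall>a\<in>P. S \<subseteq> {a..} \<longrightarrow> (\<forall>x. a \<le> x))"
  unfolding part_dense_def closed_sublocale_def atLeast_def by auto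

lemma part_image: "part (h ` L1) (h ` L2) k = h ` part L1 L2 k"
  by (simp add: part_def)

lemma surj_image: "surj f \<Longrightarrow> surj ((`) f)"
  by (rule surjI[of _ "vimage f"]) (simp add: surj_image_vimage_eq)

lemma surj_all_iff:
  assumes "surj f" shows "(\<forall>y. Q y) \<longleftrightarrow> (\<forall>x. Q (f x))"
proof (intro iffI allI)
  fix y assume "\<forall>x. Q (f x)"
  then show "Q y" using surjD[OF assms, of y] by blast
qed blast

text \<open>Only the order is assumed: reflecting it gives injectivity, and it determines infima and
  Heyting implications.\<close>

locale frame_iso =
  fixes h :: "'a::frame \<Rightarrow> 'b::frame"
  assumes surj: "surj h" and le_iff: "h x \<le> h y \<longleftrightarrow> x \<le> y"
begin

lemma bij: "bij h"
  using surj le_iff by (metis bijI injI order.antisym order_refl)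

text \<open>By surjectivity the lower set of an element consists of values of \<open>h\<close>.
  Operations characterized by what lies below them are therefore preserved.\<close>

lemma eqI_le: "(\<And>z. h z \<le> x \<longleftrightarrow> h z \<le> y) \<Longrightarrow> x = y"
  using surj by (metis order.antisym order_refl surj_def)

lemma map_inf: "h (inf x y) = inf (h x) (h y)"
  by (rule eqI_le) (simp add: le_iff)

lemma map_heyting_imp: "h (heyting_imp x y) = heyting_imp (h x) (h y)"
  by (rule eqI_le) (simp add: le_iff le_heyting_imp_iff flip: map_inf)

lemma open_sublocale_map: "open_sublocale (h a) = h ` open_sublocale a"
proof -
  have "open_sublocale (h a) = heyting_imp (h a) ` range h"
    unfolding open_sublocale_def surj by auto
  also have "\<dots> = h ` open_sublocale a"
    unfolding open_sublocale_def image_image map_heyting_imp[symmetric] by auto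
  finally show ?thesis .
qed

lemma part_open_image: "part_open (h ` P) (h ` S) \<longleftrightarrow> part_open P S"
  by (simp add: part_open_iff open_sublocale_map inj_image_eq_iff[OF bij_is_inj[OF bij]])

lemma part_dense_image: "part_dense (h ` P) (h ` S) \<longleftrightarrow> part_dense P S"
  \<comment> \<open>The bound on the right of \<open>part_dense_iff\<close> ranges over the whole
    codomain; surjectivity restricts it to values of \<open>h\<close>.\<close>
  by (simp add: part_dense_iff image_subset_iff subset_eq le_iff
      surj_all_iff[OF surj, of "\<lambda>y. h _ \<le> y"])

text \<open>Injectivity lets images commute with nonempty intersections; surjectivity covers the
  empty family, whose intersection is \<open>UNIV\<close>.\<close>

lemma Inter_image: "\<Inter> ((`) h ` \<S>) = h ` \<Inter>\<S>"
  using bij_image_INT[OF bij, of id \<S>] by simp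

lemma baire_image: "baire i j (h ` L1) (h ` L2) \<longleftrightarrow> baire i j L1 L2"
proof -
  have inj: "inj ((`) h)"
    using inj_image_eq_iff[OF bij_is_inj[OF bij]] by (auto intro: injI)
  have "surj ((`) h)"
    using surj by (rule surj_image)
  \<comment> \<open>\<open>baire\<close> quantifies over families of sets, so the image map is
    lifted twice: every family in the codomain is the image of a family in the domain.\<close>
  then have surj': "surj ((`) ((`) h))"
    by (rule surj_image)
  have count: "countable ((`) h ` \<S>) \<longleftrightarrow> countable \<S>" for \<S>
    by (rule countable_image_inj_eq[OF inj_on_subset[OF inj subset_UNIV]])
  show ?thesis
    unfolding baire_def part_image surj_all_iff[OF surj'] count Inter_image ball_simps
      part_open_image part_dense_image ..
qed

end

definition principal_ideal :: "'a::frame \<Rightarrow> 'a ideal"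
  where "principal_ideal a = Abs_ideal {..a}"

lemma ideal_set_principal: "ideal_set (principal_ideal a) = {..a}"
  unfolding principal_ideal_def
  by (rule Abs_ideal_inverse) (auto simp: is_ideal_def intro: order_trans)

lemma principal_le_iff: "principal_ideal a \<le> principal_ideal b \<longleftrightarrow> a \<le> b"
  by (simp add: less_eq_ideal.rep_eq ideal_set_principal)

lemma finite_Sup_in_ideal:
  assumes "finite F" "F \<subseteq> ideal_set J" shows "Sup F \<in> ideal_set J"
  using assms by (induction F) (simp_all add: ideal_bot ideal_sup)

lemma ideal_eq_principal_Sup:
  assumes "compact_element (Sup (ideal_set J))"
  shows "J = principal_ideal (Sup (ideal_set J))"
proof -
  \<comment> \<open>Compactness is applied to the join of \<open>J\<close> covered by
    \<open>ideal_set J\<close> itself; an ideal is closed under finite joins.\<close>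
  obtain F where "finite F" "F \<subseteq> ideal_set J" "Sup (ideal_set J) \<le> Sup F"
    using assms unfolding compact_element_def by blast
  then have "Sup (ideal_set J) \<in> ideal_set J"
    using finite_Sup_in_ideal ideal_down by blast
  then have "ideal_set J = {..Sup (ideal_set J)}"
    using Sup_upper ideal_down[of _ J] by blast
  then show ?thesis
    unfolding ideal_set_principal[symmetric] ideal_set_inject .
qed

lemma frame_iso_principal:
  assumes "\<And>x::'a::frame. compact_element x"
  shows "frame_iso (principal_ideal :: 'a \<Rightarrow> 'a ideal)"
proof
  show "surj (principal_ideal :: 'a \<Rightarrow> 'a ideal)"
    by (rule surjI[of _ "\<lambda>J. Sup (ideal_set J)"]) (rule ideal_eq_principal_Sup[OF assms, symmetric])
qed (rule principal_le_iff)

lemma principal_in_ideal_part_iff: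
  assumes "subframe P"
  shows "principal_ideal a \<in> ideal_part P \<longleftrightarrow> a \<in> P"
proof -
  have "(\<forall>x\<in>{..a}. \<exists>p\<in>{..a} \<inter> P. x \<le> p) \<longleftrightarrow> a \<in> P"
  proof
    assume "\<forall>x\<in>{..a}. \<exists>p\<in>{..a} \<inter> P. x \<le> p"
    \<comment> \<open>Taking \<open>x = a\<close> squeezes \<open>p\<close> between \<open>a\<close>
      and \<open>a\<close>.\<close>
    then obtain p where "p \<le> a" "p \<in> P" "a \<le> p" by blast
    then show "a \<in> P" using order.antisym[of p a] by simp
  qed auto
  then show ?thesis
    unfolding ideal_part_iff[OF assms] ideal_set_principal .
qed

lemma ideal_part_eq_principal_image:
  fixes P :: "'a::frame set"
  assumes "\<And>x::'a. compact_element x" "subframe P"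
  shows "ideal_part P = principal_ideal ` P"
proof -
  have "\<exists>a. J = principal_ideal a" for J :: "'a ideal"
    by (rule exI[of _ "Sup (ideal_set J)"]) (rule ideal_eq_principal_Sup[OF assms(1)])
  then have "J \<in> ideal_part P \<longleftrightarrow> J \<in> principal_ideal ` P" for J
    using principal_in_ideal_part_iff[OF assms(2)] by (metis image_iff)
  then show ?thesis by (rule set_eqI)
qed

theorem proposition2p17:
  fixes L1 L2 :: "'a::frame set" and i j :: nat
  assumes "{i, j} = {1, 2}" and "noetherian_bilocale L1 L2"
  shows "baire i j L1 L2 \<longleftrightarrow> baire i j (ideal_part L1) (ideal_part L2)"
proof -
  have cpt: "\<And>x::'a. compact_element x" and L: "subframe L1" "subframe L2"
    using assms(2) unfolding noetherian_bilocale_def bilocale_def by blast+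
  show ?thesis
    unfolding ideal_part_eq_principal_image[OF cpt L(1)] ideal_part_eq_principal_image[OF cpt L(2)]
    by (rule frame_iso.baire_image[OF frame_iso_principal[OF cpt], symmetric])
qed

end
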